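(* Let $n\ge1$. If $\mathcal{C}\subseteq\mathcal{H}^{(n)}=(\mathbb{C}^2)^{\otimes n}$ is an odd Clifford code of distance $2$ (i.e. a quantum code of distance $2$ for the $\mathrm{Cl}(2n+1)$ quantum metric), then $\dim(\mathcal{C})\le2^{n-1}$.
   Context: Odd Clifford quantum metric: with Pauli matrices $\sigma_x,\sigma_y,\sigma_z$, put $U_k=\sigma_z^{\otimes k-1}\otimes\sigma_x\otimes I_2^{\otimes n-k}$ and $U_{n+k}=\sigma_z^{\otimes k-1}\otimes\sigma_y\otimes I_2^{\otimes n-k}$ for $1\le k\le n$, and $U_{2n+1}=\sigma_z^{\otimes n}$. The $\mathrm{Cl}(2n+1)$ quantum metric is $$\mathcal{E}_t^{\mathrm{Cl}(2n+1)}=\operatorname{span}\{U_{k_1}\cdots U_{k_j}:1\le k_1<\dots<k_j\le 2n+1,\ 0\le j\le\lfloor t\rfloor\}$$ (empty product $=I$). A quantum code is a subspace $\mathcal{C}$ with orthogonal projection $P$; it detects an operator $E$ if $PEP$ is a scalar multiple of $P$; its distance is the largest $d$ such that it detects all $E\in\mathcal{E}_{d-1}$. *)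

theory Defs
  imports Complex_Main "Jordan_Normal_Form.VS_Connect" "Jordan_Normal_Form.Conjugate"
begin

section \<open>Tensor products of matrices\<close>

text \<open>The Hilbert space \<open>(\<complex>\<^sup>2)\<^sup>\<otimes>\<^sup>n\<close> is represented by \<open>\<complex>\<^sup>N\<close> with \<open>N = 2 ^ n\<close>, the tensor
  product basis being ordered lexicographically with the leftmost tensor factor most significant;
  tensor products of operators are then Kronecker products.\<close>

definition kron :: "'a :: semiring_1 mat \<Rightarrow> 'a mat \<Rightarrow> 'a mat" (infixl \<open>\<otimes>\<^sub>K\<close> 70) where
  "A \<otimes>\<^sub>K B = mat (dim_row A * dim_row B) (dim_col A * dim_col B)
     (\<lambda>(i, j). A $$ (i div dim_row B, j div dim_col B) * B $$ (i mod dim_row B, j mod dim_col B))"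

primrec tensor_power :: "'a :: semiring_1 mat \<Rightarrow> nat \<Rightarrow> 'a mat" where
  "tensor_power A 0 = 1\<^sub>m 1"
| "tensor_power A (Suc k) = A \<otimes>\<^sub>K tensor_power A k"


section \<open>The odd Clifford quantum metric\<close>

definition pauli_x :: "complex mat" where
  "pauli_x = mat_of_rows_list 2 [[0, 1], [1, 0]]"

definition pauli_y :: "complex mat" where
  "pauli_y = mat_of_rows_list 2 [[0, - \<i>], [\<i>, 0]]"

definition pauli_z :: "complex mat" where
  "pauli_z = mat_of_rows_list 2 [[1, 0], [0, - 1]]"

text \<open>\<open>clifford_gen n k\<close> is the generator \<open>U\<^sub>k\<close>; only the indices \<open>1 \<le> k \<le> 2 * n + 1\<close> are
  meaningful.\<close>

definition clifford_gen :: "nat \<Rightarrow> nat \<Rightarrow> complex mat" where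
  "clifford_gen n k =
    (if k \<le> n then
       tensor_power pauli_z (k - 1) \<otimes>\<^sub>K pauli_x \<otimes>\<^sub>K tensor_power (1\<^sub>m 2) (n - k)
     else if k \<le> 2 * n then
       tensor_power pauli_z (k - n - 1) \<otimes>\<^sub>K pauli_y \<otimes>\<^sub>K tensor_power (1\<^sub>m 2) (n - (k - n))
     else tensor_power pauli_z n)"

definition clifford_word :: "nat \<Rightarrow> nat list \<Rightarrow> complex mat" where
  "clifford_word n ks = foldr (*) (map (clifford_gen n) ks) (1\<^sub>m (2 ^ n))"

abbreviation mat_span :: "nat \<Rightarrow> complex mat set \<Rightarrow> complex mat set" where
  "mat_span N \<equiv> LinearCombinations.module.span class_ring (module_mat TYPE(complex) N N)"

definition odd_clifford_metric :: "nat \<Rightarrow> real \<Rightarrow> complex mat set" where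
  "odd_clifford_metric n t = mat_span (2 ^ n)
     {clifford_word n ks | ks. sorted_wrt (<) ks \<and> set ks \<subseteq> {1..2 * n + 1} \<and> int (length ks) \<le> \<lfloor>t\<rfloor>}"


section \<open>Quantum codes\<close>

abbreviation is_subspace :: "nat \<Rightarrow> complex vec set \<Rightarrow> bool" where
  "is_subspace N C \<equiv> VectorSpace.subspace class_ring C (module_vec TYPE(complex) N)"

abbreviation subspace_dim :: "nat \<Rightarrow> complex vec set \<Rightarrow> nat" where
  "subspace_dim N C \<equiv> vectorspace.dim class_ring (module_vec TYPE(complex) N\<lparr>carrier := C\<rparr>)"

definition is_orthogonal_projection :: "nat \<Rightarrow> complex vec set \<Rightarrow> complex mat \<Rightarrow> bool" where
  "is_orthogonal_projection N C P \<longleftrightarrow> P \<in> carrier_mat N N \<and>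
     (\<forall>v \<in> carrier_vec N. P *\<^sub>v v \<in> C \<and> (\<forall>w \<in> C. (v - P *\<^sub>v v) \<bullet>c w = 0))"

text \<open>A subspace has exactly one orthogonal projection, so the existential over \<open>P\<close> below merely
  names it.\<close>

definition detects :: "nat \<Rightarrow> complex vec set \<Rightarrow> complex mat \<Rightarrow> bool" where
  "detects N C E \<longleftrightarrow> (\<exists>P. is_orthogonal_projection N C P \<and> (\<exists>c. P * E * P = c \<cdot>\<^sub>m P))"

text \<open>The distance is an integer: \<open>\<E> t\<close> depends only on \<open>\<lfloor>t\<rfloor>\<close>, so a largest real value never
  exists. A code that detects everything, e.g. a one-dimensional one, has no distance in this
  sense.\<close>

definition has_distance :: "nat \<Rightarrow> (real \<Rightarrow> complex mat set) \<Rightarrow> complex vec set \<Rightarrow> nat \<Rightarrow> bool" where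
  "has_distance N \<E> C d \<longleftrightarrow>
     (\<forall>E \<in> \<E> (real d - 1). detects N C E) \<and>
     (\<forall>d'. (\<forall>E \<in> \<E> (real d' - 1). detects N C E) \<longrightarrow> d' \<le> d)"

definition odd_clifford_code :: "nat \<Rightarrow> nat \<Rightarrow> complex vec set \<Rightarrow> bool" where
  "odd_clifford_code n d C \<longleftrightarrow>
     is_subspace (2 ^ n) C \<and> has_distance (2 ^ n) (odd_clifford_metric n) C d"

end

theory Submission
  imports Defs
begin

text \<open>A single generator suffices. Let \<open>U = \<sigma>\<^sub>x \<otimes> I\<close> be the first one and let \<open>P * U * P = c \<cdot> P\<close>.
  Choose a sign \<open>s\<close> with \<open>s \<noteq> - c\<close>. A code vector \<open>v\<close> with \<open>U v = - s v\<close> satisfies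
  \<open>c v = P U P v = - s v\<close> and hence vanishes, so the code meets the \<open>- s\<close> eigenspace of \<open>U\<close>
  trivially. That eigenspace has codimension \<open>2 ^ (n - 1)\<close>: as \<open>U\<close> swaps the two halves of a vector,
  it is the kernel of the map adding \<open>s\<close> times the lower half to the upper half.\<close>

text \<open>A vanishing combination of the images pulls back along the injective \<open>T\<close> to
  a combination of \<open>A\<close> with the same coefficients, which must vanish as well.\<close>

lemma (in linear_map) lin_indpt_inj_image:
  assumes inj: "inj_on T (carrier V)" and A: "A \<subseteq> carrier V" "finite A"
    and li: "V.module.lin_indpt A"
  shows "W.module.lin_indpt (T ` A)"
proof (rule W.module.finite_lin_indpt2)
  show "finite (T ` A)" "T ` A \<subseteq> carrier W"
    using A by auto
  fix a assume a: "a \<in> T ` A \<rightarrow> carrier K" and 0: "W.module.lincomb a (T ` A) = \<zero>\<^bsub>W\<^esub>"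
  have aT: "a \<circ> T \<in> A \<rightarrow> carrier K"
    using a by auto
  have "T (V.module.lincomb (a \<circ> T) A) = T \<zero>\<^bsub>V\<^esub>"
    using lincomb_linear_image[OF inj A(1) a A(2)] 0 by simp
  then have "V.module.lincomb (a \<circ> T) A = \<zero>\<^bsub>V\<^esub>"
    by (rule inj_onD[OF inj]) (use A aT in auto)
  then show "\<forall>w\<in>T ` A. a w = \<zero>\<^bsub>K\<^esub>"
    using V.module.lin_dep_crit[OF A(2) subset_refl aT] li by auto
qed

text \<open>Finite dimension of the source is derived here: \<open>T\<close> carries independent
  sets to independent sets of the same size, so \<open>W.dim\<close> bounds them all, and a maximal
  one is a finite basis.\<close>

lemma (in linear_map) dim_le_inj:
  assumes inj: "inj_on T (carrier V)" and fin: "W.fin_dim"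
  shows "V.dim \<le> W.dim"
proof -
  have card_le: "card A \<le> W.dim"
    if "A \<subseteq> carrier V" "V.module.lin_indpt A" "finite A" for A
  proof -
    have "T ` A \<subseteq> carrier W"
      using that(1) by blast
    from W.li_le_dim(2)[OF fin this lin_indpt_inj_image[OF inj that(1,3,2)]] show ?thesis
      unfolding card_image[OF inj_on_subset[OF inj that(1)]] .
  qed
  have bound: "finite A \<and> card A \<le> W.dim" if A: "A \<subseteq> carrier V \<and> V.module.lin_indpt A" for A
  proof (cases "finite A")
    case False
    \<comment> \<open>An infinite independent set would contain an independent subset with one
      element more than \<open>W.dim\<close> allows.\<close>
    then obtain B where B: "B \<subseteq> A" "finite B" "card B = Suc W.dim"
      by (metis infinite_arbitrarily_large)
    moreover have "V.module.lin_indpt B"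
      using A B(1) by (intro V.module.subset_li_is_li[of A B]) simp_all
    ultimately show ?thesis
      using card_le[of B] A by force
  next
    case True
    then show ?thesis
      using A card_le[of A] by blast
  qed
  \<comment> \<open>The empty set witnesses that some independent set exists; with the bound on
    sizes this yields a maximal one.\<close>
  have "V.module.lin_indpt {}"
    by (simp add: V.module.lin_dep_def)
  then obtain A where A: "finite A" "maximal A (\<lambda>S. S \<subseteq> carrier V \<and> V.module.lin_indpt S)"
    using maximal_exists[of "\<lambda>S. S \<subseteq> carrier V \<and> V.module.lin_indpt S" W.dim "{}"] bound by blast
  then have "V.dim = card A"
    by (intro V.dim_basis V.max_li_is_basis)
  then show ?thesis
    using A(2) bound[of A] unfolding maximal_def by metis
qed

lemma one_kron: "1\<^sub>m 1 \<otimes>\<^sub>K A = A"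
  by (rule eq_matI) (auto simp: kron_def)

lemma kron_one: "1\<^sub>m a \<otimes>\<^sub>K 1\<^sub>m b = (1\<^sub>m (a * b) :: 'a :: semiring_1 mat)"
proof (rule eq_matI)
  fix i j assume "i < dim_row (1\<^sub>m (a * b) :: 'a mat)" "j < dim_col (1\<^sub>m (a * b) :: 'a mat)"
  then have ij: "i < a * b" "j < a * b" by simp_all
  then have "b > 0" by (cases b) simp_all
  then have "i div b < a" "j div b < a" "i mod b < b" "j mod b < b"
    using ij by (simp_all add: less_mult_imp_div_less)
  then have "(1\<^sub>m a \<otimes>\<^sub>K 1\<^sub>m b) $$ (i, j)
      = (if i div b = j div b \<and> i mod b = j mod b then 1 else 0 :: 'a)"
    using ij by (simp add: kron_def)
  moreover have "i = j" if "i div b = j div b" "i mod b = j mod b"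
  proof -
    have "i = i div b * b + i mod b"
      by simp
    also have "\<dots> = j div b * b + j mod b"
      by (simp only: that)
    finally show ?thesis
      by simp
  qed
  ultimately show "(1\<^sub>m a \<otimes>\<^sub>K 1\<^sub>m b) $$ (i, j) = (1\<^sub>m (a * b) :: 'a mat) $$ (i, j)"
    using ij by (cases "i = j") auto
qed (simp_all add: kron_def)

lemma tensor_power_one: "tensor_power (1\<^sub>m a) k = 1\<^sub>m (a ^ k)"
  by (induction k) (simp_all add: kron_one)

lemma clifford_gen_1: "clifford_gen (Suc m) 1 = pauli_x \<otimes>\<^sub>K 1\<^sub>m (2 ^ m)"
proof -
  have "clifford_gen (Suc m) 1
      = tensor_power pauli_z 0 \<otimes>\<^sub>K pauli_x \<otimes>\<^sub>K tensor_power (1\<^sub>m 2) m"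
    by (simp add: clifford_gen_def)
  then show ?thesis
    unfolding tensor_power_one tensor_power.simps(1) one_kron .
qed

lemma pauli_x_carrier: "pauli_x \<in> carrier_mat 2 2"
  by (rule carrier_matI) (simp_all add: pauli_x_def mat_of_rows_list_def)

lemma kron_one_carrier: "A \<in> carrier_mat r c \<Longrightarrow> A \<otimes>\<^sub>K 1\<^sub>m k \<in> carrier_mat (r * k) (c * k)"
  by (auto simp: kron_def)

text \<open>The leftmost tensor factor is the most significant digit of an index, so flipping it
  exchanges the two halves of the coordinates.\<close>

lemma pauli_x_kron_one_mult_vec:
  assumes v: "v \<in> carrier_vec (2 * M)"
  shows "(pauli_x \<otimes>\<^sub>K 1\<^sub>m M) *\<^sub>v v = vec (2 * M) (\<lambda>i. if i < M then v $ (i + M) else v $ (i - M))"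
proof (rule eq_vecI)
  fix i assume "i < dim_vec (vec (2 * M) (\<lambda>i. if i < M then v $ (i + M) else v $ (i - M)))"
  then have i: "i < 2 * M" by simp
  \<comment> \<open>The matrix is a permutation matrix; \<open>i'\<close> is the only column in
    which row \<open>i\<close> has a nonzero entry.\<close>
  define i' where "i' = (if i < M then i + M else i - M)"
  have i': "i' < 2 * M"
    using i by (auto simp: i'_def)
  have entry: "(pauli_x \<otimes>\<^sub>K 1\<^sub>m M) $$ (i, j) = (if j = i' then 1 else 0)" if j: "j < 2 * M" for j
  proof -
    \<comment> \<open>The quotient by \<open>M\<close> is the index into \<open>pauli_x\<close>, the
      remainder the index into the identity factor.\<close>
    have div_mod: "k div M = (if k < M then 0 else 1)" "k mod M = (if k < M then k else k - M)"
      if "k < 2 * M" for k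
      using that by (auto simp: div_if mod_if)
    show ?thesis
      using i j by (auto simp: kron_def pauli_x_def mat_of_rows_list_def div_mod i'_def)
  qed
  have "((pauli_x \<otimes>\<^sub>K 1\<^sub>m M) *\<^sub>v v) $ i
      = (\<Sum>j = 0..<2 * M. (pauli_x \<otimes>\<^sub>K 1\<^sub>m M) $$ (i, j) * v $ j)"
    using v i kron_one_carrier[OF pauli_x_carrier, of M] by (auto simp: scalar_prod_def)
  also have "\<dots> = (\<Sum>j = 0..<2 * M. if j = i' then v $ j else 0)"
    by (rule sum.cong) (simp_all add: entry)
  also have "\<dots> = v $ i'"
    using i' by simp
  finally show "((pauli_x \<otimes>\<^sub>K 1\<^sub>m M) *\<^sub>v v) $ i
      = vec (2 * M) (\<lambda>i. if i < M then v $ (i + M) else v $ (i - M)) $ i"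
    using i by (simp add: i'_def)
qed (use kron_one_carrier[OF pauli_x_carrier, of M] in auto)

lemma clifford_gen_1_in_metric: "clifford_gen (Suc m) 1 \<in> odd_clifford_metric (Suc m) 1"
proof -
  interpret matrix_vs "2 ^ Suc m" "2 ^ Suc m" "TYPE(complex)" .
  let ?S = "{clifford_word (Suc m) ks |ks. sorted_wrt (<) ks \<and> set ks \<subseteq> {1..2 * Suc m + 1}
    \<and> int (length ks) \<le> \<lfloor>1::real\<rfloor>}"
  let ?S1 = "{clifford_word (Suc m) [1]}"
  have "clifford_gen (Suc m) 1 \<in> carrier_mat (2 ^ Suc m) (2 ^ Suc m)"
    unfolding clifford_gen_1 using kron_one_carrier[OF pauli_x_carrier] by simp
  then have eq: "clifford_word (Suc m) [1] = clifford_gen (Suc m) 1"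
    and sub: "?S1 \<subseteq> carrier_mat (2 ^ Suc m) (2 ^ Suc m)"
    by (simp_all add: clifford_word_def)
  have "?S1 \<subseteq> ?S"
    by (auto intro!: exI[of _ "[1]"])
  then show ?thesis
    using in_own_span[OF sub] span_is_monotone[of ?S1 ?S]
    unfolding odd_clifford_metric_def eq by blast
qed

lemma smult_mat_mult_vec:
  assumes "A \<in> carrier_mat r c" "v \<in> carrier_vec c"
  shows "(a \<cdot>\<^sub>m A) *\<^sub>v v = a \<cdot>\<^sub>v (A *\<^sub>v v)"
  using assms by (intro eq_vecI) (auto simp: smult_scalar_prod_distrib[of _ c])

text \<open>For \<open>v\<close> in \<open>C\<close> the difference \<open>v - P *\<^sub>v v\<close>
  lies in \<open>C\<close> and is orthogonal to \<open>C\<close>, hence to itself.\<close>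

lemma orthogonal_projection_fixes:
  assumes P: "is_orthogonal_projection N C P" and C: "is_subspace N C" and v: "v \<in> C"
  shows "P *\<^sub>v v = v"
proof -
  interpret vec_space "TYPE(complex)" N .
  have sub: "submodule class_ring C V"
    using C by (simp add: subspace_def)
  have v_carrier: "v \<in> carrier_vec N"
    using submodule.subset[OF sub] v by auto
  have Pv: "P *\<^sub>v v \<in> C" "P *\<^sub>v v \<in> carrier_vec N"
    using P v_carrier by (auto simp: is_orthogonal_projection_def)
  have "- 1 \<cdot>\<^sub>v (P *\<^sub>v v) \<in> C"
    using submodule.smult_closed[OF sub, of "- 1"] Pv by (simp add: class_ring_simps)
  then have "v + - 1 \<cdot>\<^sub>v (P *\<^sub>v v) \<in> C"
    using submodule.m_closed[OF sub v] by simp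
  moreover have "v + - 1 \<cdot>\<^sub>v (P *\<^sub>v v) = v - P *\<^sub>v v"
    using v_carrier Pv by (intro eq_vecI) auto
  ultimately have "(v - P *\<^sub>v v) \<bullet>c (v - P *\<^sub>v v) = 0"
    using P v_carrier by (auto simp: is_orthogonal_projection_def)
  then have 0: "v - P *\<^sub>v v = 0\<^sub>v N"
    using conjugate_square_eq_0_vec[of "v - P *\<^sub>v v" N] v_carrier Pv by auto
  have "v $ i = (P *\<^sub>v v) $ i" if "i < N" for i
    using arg_cong[OF 0, of "\<lambda>w. w $ i"] that v_carrier P
    by (auto simp: is_orthogonal_projection_def)
  then show ?thesis
    using v_carrier P by (intro eq_vecI) (auto simp: is_orthogonal_projection_def)
qed

theorem corollary3p5p1:
  fixes n :: nat and C :: "complex vec set"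
  assumes "n \<ge> 1"
    and "odd_clifford_code n 2 C"
  shows "subspace_dim (2 ^ n) C \<le> 2 ^ (n - 1)"
proof -
  obtain m where n: "n = Suc m"
    using assms(1) by (cases n) auto
  define M :: nat where "M = 2 ^ m"
  have N: "2 ^ n = 2 * M"
    by (simp add: n M_def)
  define U where "U = pauli_x \<otimes>\<^sub>K 1\<^sub>m M"
  have U_carrier: "U \<in> carrier_mat (2 * M) (2 * M)"
    unfolding U_def by (rule kron_one_carrier[OF pauli_x_carrier])
  have C: "is_subspace (2 * M) C"
    using assms(2) by (simp add: odd_clifford_code_def N)
  \<comment> \<open>Distance 2 means detection at t = 2 - 1 = 1, where the metric contains
    \<open>U\<close>.\<close>
  have "detects (2 * M) C U"
    using assms(2) clifford_gen_1_in_metric[of m, unfolded clifford_gen_1]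
    by (simp add: odd_clifford_code_def has_distance_def n U_def M_def)
  then obtain P c where P: "is_orthogonal_projection (2 * M) C P" and PUP: "P * U * P = c \<cdot>\<^sub>m P"
    by (auto simp: detects_def)
  have P_carrier: "P \<in> carrier_mat (2 * M) (2 * M)"
    using P by (simp add: is_orthogonal_projection_def)
  define s where "s = (if c = - 1 then - 1 else 1 :: complex)"
  have s: "c + s \<noteq> 0" "s * s = 1"
    by (auto simp: s_def add_eq_0_iff2)
  define T where "T = (\<lambda>v. vec M (\<lambda>i. v $ i + s * v $ (i + M)))"

  interpret X: vec_space "TYPE(complex)" "2 * M" .
  interpret Y: vec_space "TYPE(complex)" M .
  have sub: "submodule class_ring C X.V"
    using C by (simp add: subspace_def)
  have C_carrier: "v \<in> carrier_vec (2 * M)" if "v \<in> C" for v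
    using submodule.subset[OF sub] that by auto
  interpret T: linear_map class_ring "X.vs C" Y.V T
  proof (intro linear_map.intro mod_hom.intro)
    show "vectorspace class_ring (X.vs C)"
      by (rule X.subspace_is_vs[OF C])
    show "vectorspace class_ring Y.V"
      by (rule vec_vs)
    show "module class_ring (X.vs C)"
      by (rule vectorspace.axioms(1)[OF X.subspace_is_vs[OF C]])
    show "module class_ring Y.V"
      by (rule vec_module)
    show "mod_hom_axioms class_ring (X.vs C) Y.V T"
      unfolding mod_hom_axioms_def LinearCombinations.module_hom_def
      by (auto simp: T_def class_ring_simps module_vec_simps dest!: C_carrier
          intro!: eq_vecI simp: algebra_simps)
  qed
  have ker: "v = 0\<^sub>v (2 * M)" if v: "v \<in> C" and Tv: "T v = 0\<^sub>v M" for v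
  proof -
    note vc = C_carrier[OF v]
    have Pv: "P *\<^sub>v v = v"
      by (rule orthogonal_projection_fixes[OF P C v])
    have 0: "v $ i = - s * v $ (i + M)" if "i < M" for i
      using arg_cong[OF Tv, of "\<lambda>w. w $ i"] that by (simp add: T_def add_eq_0_iff2)
    have Uv: "U *\<^sub>v v = - s \<cdot>\<^sub>v v"
      unfolding U_def pauli_x_kron_one_mult_vec[OF vc]
    proof (rule eq_vecI)
      fix i assume "i < dim_vec (- s \<cdot>\<^sub>v v)"
      then have i: "i < 2 * M" using vc by simp
      show "vec (2 * M) (\<lambda>i. if i < M then v $ (i + M) else v $ (i - M)) $ i = (- s \<cdot>\<^sub>v v) $ i"
      proof (cases "i < M")
        case True
        \<comment> \<open>The relation \<open>0\<close> expresses the upper half through the lower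
          one; since \<open>s\<close> is its own inverse, it can be solved for the lower
          half.\<close>
        have "v $ (i + M) = - s * v $ i"
          unfolding 0[OF True] using s(2) by (simp flip: mult.assoc)
        with True vc show ?thesis by simp
      next
        case False
        then have "v $ (i - M) = - s * v $ i"
          using 0[of "i - M"] i by simp
        with False i vc show ?thesis by simp
      qed
    qed (use vc in auto)
    \<comment> \<open>The vector P U P v is evaluated twice: by detection it is c v, and by the
      eigenvalue equation it is -s v.\<close>
    have "c \<cdot>\<^sub>v v = (P * U * P) *\<^sub>v v"
      unfolding PUP smult_mat_mult_vec[OF P_carrier vc] Pv ..
    also have "\<dots> = P *\<^sub>v (U *\<^sub>v (P *\<^sub>v v))"
      using P_carrier U_carrier vc by (simp add: assoc_mult_mat_vec[of _ "2 * M" "2 * M" _ "2 * M"])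
    also have "\<dots> = - s \<cdot>\<^sub>v v"
      using P_carrier vc by (simp add: Pv Uv mult_mat_vec[of _ "2 * M" "2 * M"])
    finally have eq: "c \<cdot>\<^sub>v v = - s \<cdot>\<^sub>v v" .
    show ?thesis
    proof (rule eq_vecI)
      fix i assume "i < dim_vec (0\<^sub>v (2 * M) :: complex vec)"
      then have i: "i < 2 * M" by simp
      have "(c + s) * v $ i = 0"
        using arg_cong[OF eq, of "\<lambda>w. w $ i"] i vc by (simp add: algebra_simps)
      then show "v $ i = 0\<^sub>v (2 * M) $ i"
        using s(1) i by simp
    qed (use vc in simp)
  qed
  \<comment> \<open>Injectivity follows from the trivial kernel; the zero vector itself belongs to
    the code because \<open>C\<close> is a submodule.\<close>
  have "inj_on T (carrier (X.vs C))"
  proof (rule T.Ke0_imp_inj)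
    have "v = \<zero>\<^bsub>X.vs C\<^esub>" if "v \<in> T.kerT" for v
      using ker[of v] that by (simp add: T.ker_def)
    moreover have "\<zero>\<^bsub>X.vs C\<^esub> \<in> T.kerT"
      unfolding T.ker_def using T.T0_is_0 submodule.zero_closed[OF sub] by simp
    ultimately have "T.kerT = {\<zero>\<^bsub>X.vs C\<^esub>}"
      by blast
    then show "carrier (X.vs C\<lparr>carrier := T.kerT\<rparr>) = {\<zero>\<^bsub>X.vs C\<^esub>}"
      by simp
  qed
  then have "T.V.dim \<le> Y.dim"
    by (rule T.dim_le_inj) simp
  then show ?thesis
    unfolding Y.dim_is_n by (simp add: N n M_def)
qed

end
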